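(* Let $n\ge1$ and write the Yablonskii--Vorob'ev polynomial as $Q_n(z)=\sum_{k=0}^{n(n+1)/2}A_{n,k}z^{n(n+1)/2-k}$, $A_{n,0}=1$. Then $Q_n(z)=z^{n(n+1)/2}+A_{n,3}z^{n(n+1)/2-3}+A_{n,6}z^{n(n+1)/2-6}+\cdots$ (only powers $z^{n(n+1)/2-3k}$ occur), and for each $k\in\{1,\dots,9\}$ with $3k\le n(n+1)/2$ the coefficient $A_{n,3k}$ is given by the corresponding formula: $$A_{n,3}=\tfrac{n}{6}(n^2-1)(n+2),$$ $$A_{n,6}=\tfrac{n}{72}(n^2-1)(n^2-4)(n-4)(n+5)(n+3),$$ $$A_{n,9}=\tfrac{n}{1296}(n^2-1)(n^2-4)(n^2-9)(n+4)(n^4+2n^3-57n^2-58n+1120),$$ $$A_{n,12}=\tfrac{n}{31104}(n^2-1)(n^2-4)(n^2-9)(n^2-16)(n+5)(n^6+3n^5-109n^4-223n^3+5148n^2+5260n-110880),$$ $$A_{n,15}=\tfrac{n}{933120}(n^2-1)(n^2-4)(n^2-9)(n^2-16)(n+5)[n^{10}+5n^9-200n^8-830n^7+18917n^6+59677n^5-1072550n^4-2245540n^3+35648392n^2+36781248n-484323840],$$ $$A_{n,18}=\tfrac{n}{33592320}(n^2-1)(n^2-4)(n^2-9)(n^2-16)(n^2-25)(n+6)[n^{12}+6n^{11}-287n^{10}-1490n^9+40087n^8+169354n^7-3558197n^6-11273654n^5+213009052n^4+445008120n^3-7958672096n^2-8183083776n+131736084480],$$ $$A_{n,21}=\tfrac{n}{1410877440}(n^2-1)(n^2-4)(n^2-9)(n^2-16)(n^2-25)(n+6)[n^{16}+8n^{15}-420n^{14}-3080n^{13}+87206n^{12}+563640n^{11}-11872404n^{10}-64603080n^9+1168725105n^8+5068846496n^7-84738361232n^6-272233713360n^5+4305162496688n^4+9070093877056n^3-132946555052544n^2-137527838945280n+1802149635686400],$$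 $$A_{n,24}=\tfrac{n}{67722117120}(n^2-1)(n^2-4)(n^2-9)(n^2-16)(n^2-25)(n^2-36)(n^2-49)(n+8)[n^{16}+8n^{15}-492n^{14}-3584n^{13}+121478n^{12}+775824n^{11}-20020068n^{10}-107298432n^9+2443900401n^8+10428074408n^7-227804919608n^6-720372362304n^5+15749707896080n^4+32712421425280n^3-723511683854592n^2-739989727488000n+16283709208166400],$$ $$A_{n,27}=\tfrac{n}{3656994324480}(n^2-1)(n^2-4)(n^2-9)(n^2-16)(n^2-25)(n^2-36)(n+7)[n^{22}+11n^{21}-715n^{20}-7535n^{19}+255960n^{18}+2520582n^{17}-61352518n^{16}-548941070n^{15}+11058177409n^{14}+87218618983n^{13}-1583236002911n^{12}-10658996892035n^{11}+183545605960118n^{10}+1017581723269944n^9-17057801205684864n^8-74457629190856880n^7+1221271897326432992n^6+3928812356965402880n^5-62376250932962964992n^4-131389485437862420480n^3+1976136057743843819520n^2+2042498326581057945600n-28450896728508334080000].$$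
   Context: Yablonskii--Vorob'ev polynomials: $Q_0(z)=1$, $Q_1(z)=z$, and $Q_{n+1}Q_{n-1}=zQ_n^2-4\left(Q_nQ_n''-(Q_n')^2\right)$ for $n\ge 1$. Known facts taken as given: each $Q_n$ is a monic polynomial with integer coefficients, of degree $n(n+1)/2$, with only simple roots, and for $n\ge1$ the function $w(z;n)=\frac{d}{dz}\ln\frac{Q_{n-1}(z)}{Q_n(z)}$ is a rational solution of the second Painlevé equation $w_{zz}=2w^3+zw+\alpha$ with $\alpha=n$. *)

theory Defs
  imports Complex_Main "HOL-Computational_Algebra.Computational_Algebra"
begin

definition yv_rhs :: "complex poly \<Rightarrow> complex poly" where
  "yv_rhs f = [:0, 1:] * f ^ 2 - 4 * (f * pderiv (pderiv f) - (pderiv f) ^ 2)"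

text \<open>
  The recurrence \<open>Q (n+1) * Q (n-1) = z * Q n ^ 2 - 4 * (Q n * Q n'' - (Q n') ^ 2)\<close> is solved
  for \<open>Q (n+1)\<close> by polynomial division. A priori this \<^term>\<open>(div)\<close> could leave a remainder;
  lemma \<open>yv_recurrence\<close> below shows that it never does, so that the recurrence holds literally,
  and lemma \<open>yv_unique\<close> shows that it determines the sequence.
\<close>

fun yv :: "nat \<Rightarrow> complex poly" where
  "yv 0 = 1"
| "yv (Suc 0) = [:0, 1:]"
| "yv (Suc (Suc n)) = yv_rhs (yv (Suc n)) div yv n"

text \<open>
  Coefficients are counted from the top degree \<open>n * (n + 1) div 2\<close>. The subtraction on
  \<^typ>\<open>nat\<close> makes \<open>yv_coeff n k\<close> meaningful only for \<open>k \<le> n * (n + 1) div 2\<close>.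
\<close>

definition yv_coeff :: "nat \<Rightarrow> nat \<Rightarrow> complex" where
  "yv_coeff n k = coeff (yv n) (n * (n + 1) div 2 - k)"


lemma pderiv_yv_rhs:
  "pderiv (yv_rhs f) = f ^ 2 + 2 * [:0, 1:] * f * pderiv f
     - 4 * f * pderiv (pderiv (pderiv f)) + 4 * pderiv f * pderiv (pderiv f)"
proof -
  have four: "pderiv (4 :: complex poly) = 0"
    by simp
  have X: "pderiv [:0, 1 :: complex:] = 1"
    by (simp add: pderiv_pCons)
  show ?thesis
    unfolding yv_rhs_def
    by (simp only: pderiv_diff pderiv_mult pderiv_power four X power2_eq_square)
       (simp add: algebra_simps)
qed

lemma yv_rhs_dvd_step:
  assumes ab: "a * b = yv_rhs f" and fa: "f dvd yv_rhs a"
  shows "f dvd a ^ 2 * yv_rhs b"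
proof -
  define X :: "complex poly" where "X = [:0, 1:]"
  define g where "g = pderiv f"
  define s where "s = pderiv g"
  define t where "t = pderiv s"
  define h where "h = yv_rhs f"
  have dX: "pderiv X = 1" by (simp add: X_def pderiv_pCons)
  have d4: "pderiv (4 :: complex poly) = 0" by simp
  define u where "u = X * f - 4 * s"
  define v where "v = f + 2 * X * g - 4 * t"
  define w where "w = pderiv v + g"
  have h0: "h = 4 * g ^ 2 + f * u"
    by (simp add: h_def yv_rhs_def u_def X_def[symmetric] g_def[symmetric] s_def[symmetric]
        algebra_simps power2_eq_square)
  have h1: "pderiv h = 4 * g * s + f * v"
    unfolding h_def pderiv_yv_rhs v_def
    by (simp add: X_def[symmetric] g_def[symmetric] s_def[symmetric] t_def[symmetric]
        algebra_simps power2_eq_square)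
  have h2: "pderiv (pderiv h) = 4 * s ^ 2 + 2 * X * g ^ 2 + f * w"
    unfolding h1 w_def
    by (simp add: pderiv_add pderiv_mult d4 g_def[symmetric] s_def[symmetric] t_def[symmetric])
       (simp add: v_def algebra_simps power2_eq_square)
  have H: "yv_rhs h + X * h ^ 2 =
      f * (2 * X * (8 * g ^ 2 * u + f * u ^ 2)
        - 4 * (4 * g ^ 2 * w + u * (4 * s ^ 2 + 2 * X * g ^ 2) + f * u * w)
        + 4 * (8 * g * s * v + f * v ^ 2))"
    unfolding yv_rhs_def X_def[symmetric] h2 unfolding h1 unfolding h0 by algebra
  have prod: "a ^ 2 * yv_rhs b = yv_rhs (a * b) + X * (a * b) ^ 2 - b ^ 2 * yv_rhs a"
    unfolding yv_rhs_def X_def[symmetric] pderiv_mult pderiv_add by algebra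
  have "a ^ 2 * yv_rhs b = (yv_rhs h + X * h ^ 2) - b ^ 2 * yv_rhs a"
    using prod ab h_def by simp
  then show ?thesis
    using fa H by (metis dvd_diff dvd_mult dvd_triv_left)
qed

lemma dvd_mult_cancel_no_common_root:
  fixes f a g :: "complex poly"
  assumes "f dvd a * g" and "f \<noteq> 0" and "\<And>x. poly f x = 0 \<Longrightarrow> poly a x \<noteq> 0"
  shows "f dvd g"
  using assms
proof (induction "degree f" arbitrary: f g rule: less_induct)
  case less
  show ?case
  proof (cases "degree f = 0")
    case True
    then show ?thesis using \<open>f \<noteq> 0\<close> is_unit_iff_degree unit_imp_dvd by blast
  next
    case False
    then have "\<not> constant (poly f)" by (simp add: constant_degree)
    then obtain x where x: "poly f x = 0" using fundamental_theorem_of_algebra by blast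
    then obtain f' where f': "f = [:-x, 1:] * f'" by (meson dvdE poly_eq_0_iff_dvd)
    have "poly (a * g) x = 0" using less.prems(1) x by (metis dvd_trans poly_eq_0_iff_dvd)
    then have "poly g x = 0" using less.prems(3)[OF x] by simp
    then obtain g' where g': "g = [:-x, 1:] * g'" by (meson dvdE poly_eq_0_iff_dvd)
    have "f' \<noteq> 0" using \<open>f \<noteq> 0\<close> f' by auto
    then have "degree f' < degree f"
      unfolding f' by (subst degree_mult_eq) auto
    moreover have "[:-x, 1:] * f' dvd [:-x, 1:] * (a * g')"
      using less.prems(1) unfolding f' g' by (simp only: mult.left_commute)
    then have "f' dvd a * g'" by (subst (asm) dvd_mult_cancel_left) simp
    moreover have "poly a y \<noteq> 0" if "poly f' y = 0" for y
      using less.prems(3)[of y] that unfolding f' by simp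
    ultimately have "f' dvd g'" using less.hyps[of f' g'] \<open>f' \<noteq> 0\<close> by blast
    then show ?thesis unfolding f' g' by (rule mult_dvd_mono[OF dvd_refl])
  qed
qed

definition yv_inv :: "nat \<Rightarrow> complex poly \<Rightarrow> complex poly \<Rightarrow> complex poly \<Rightarrow> bool" where
  "yv_inv n a f b \<longleftrightarrow>
     a * b = yv_rhs f \<and> f dvd yv_rhs a \<and>
     a * pderiv b - pderiv a * b = of_nat (2 * n + 3) * f ^ 2 \<and>
     pderiv (pderiv f) * b - 2 * pderiv f * pderiv b + f * pderiv (pderiv b) = 0 \<and>
     (\<forall>x. poly f x = 0 \<longrightarrow> poly (pderiv f) x \<noteq> 0) \<and> f \<noteq> 0 \<and> b \<noteq> 0"

lemma yv_inv_step:
  assumes "yv_inv n a f b"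
  shows "f dvd yv_rhs b" "yv_inv (Suc n) f b (yv_rhs b div f)"
proof -
  have ab: "a * b = yv_rhs f" and fa: "f dvd yv_rhs a"
    and W: "a * pderiv b - pderiv a * b = of_nat (2 * n + 3) * f ^ 2"
    and D0: "pderiv (pderiv f) * b - 2 * pderiv f * pderiv b + f * pderiv (pderiv b) = 0"
    and sf: "\<And>x. poly f x = 0 \<Longrightarrow> poly (pderiv f) x \<noteq> 0" and f0: "f \<noteq> 0" and b0: "b \<noteq> 0"
    using assms unfolding yv_inv_def by auto
  define X :: "complex poly" where "X = [:0, 1:]"
  have d2: "pderiv (2 :: complex poly) = 0" by simp
  have no_common: "poly (a * b) x \<noteq> 0" if "poly f x = 0" for x
    using sf[OF that] that unfolding ab yv_rhs_def by simp
  have sb: "poly (pderiv b) x \<noteq> 0" if "poly b x = 0" for x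
  proof
    assume "poly (pderiv b) x = 0"
    then have "poly (a * pderiv b - pderiv a * b) x = 0" using that by simp
    then have "poly (of_nat (2 * n + 3) * f ^ 2) x = 0" unfolding W .
    then have "of_nat (2 * n + 3) * poly f x ^ 2 = 0"
      by (simp only: poly_mult poly_of_nat poly_power)
    moreover have "(of_nat (2 * n + 3) :: complex) \<noteq> 0"
      by (simp only: of_nat_eq_0_iff)
    ultimately have "poly f x = 0"
      by (simp only: mult_eq_0_iff power_eq_0_iff) blast
    then show False using no_common[of x] that by simp
  qed
  have "poly (a ^ 2) x \<noteq> 0" if "poly f x = 0" for x
    using no_common[OF that] by simp
  then show dv: "f dvd yv_rhs b"
    by (rule dvd_mult_cancel_no_common_root[OF yv_rhs_dvd_step[OF ab fa] f0])
  define c where "c = yv_rhs b div f"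
  have fc: "f * c = yv_rhs b" using dv c_def by simp
  define f1 where "f1 = pderiv f"
  define f2 where "f2 = pderiv f1"
  define f3 where "f3 = pderiv f2"
  define b1 where "b1 = pderiv b"
  define b2 where "b2 = pderiv b1"
  define b3 where "b3 = pderiv b2"
  define a1 where "a1 = pderiv a"
  define c1 where "c1 = pderiv c"
  define c2 where "c2 = pderiv c1"
  note fl = f1_def[symmetric] f2_def[symmetric] f3_def[symmetric]
    b1_def[symmetric] b2_def[symmetric] b3_def[symmetric]
    a1_def[symmetric] c1_def[symmetric] c2_def[symmetric] X_def[symmetric]
  define M :: "complex poly" where "M = of_nat (2 * n + 3)"
  have M2: "M + 2 = of_nat (2 * Suc n + 3)" by (simp add: M_def)
  have dM: "pderiv (M + 2) = 0" unfolding M2 by (rule pderiv_of_nat)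
  define k where "k = X * f ^ 2 - 4 * (f * f2 - f1 ^ 2)"
  define k1 where "k1 = f ^ 2 + 2 * X * f * f1 - 4 * f * f3 + 4 * f1 * f2"
  define h where "h = X * b ^ 2 - 4 * (b * b2 - b1 ^ 2)"
  define h1 where "h1 = b ^ 2 + 2 * X * b * b1 - 4 * b * b3 + 4 * b1 * b2"
  have k: "a * b = k" using ab unfolding yv_rhs_def fl k_def .
  have h: "f * c = h" using fc unfolding yv_rhs_def fl h_def .
  have "pderiv (a * b) = k1" unfolding ab pderiv_yv_rhs fl k1_def ..
  then have k1: "a * b1 + b * a1 = k1" unfolding pderiv_mult fl .
  have "pderiv (f * c) = h1" unfolding fc pderiv_yv_rhs fl h1_def ..
  then have h1: "f * c1 + c * f1 = h1" unfolding pderiv_mult fl .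
  have W': "a * b1 - a1 * b = M * f ^ 2" using W unfolding fl M_def .
  have D0': "f2 * b - 2 * f1 * b1 + f * b2 = 0" using D0 unfolding fl .
  have "pderiv (f2 * b - 2 * f1 * b1 + f * b2) = 0" unfolding D0' by simp
  then have D1: "f3 * b - f2 * b1 - f1 * b2 + f * b3 = 0"
    unfolding pderiv_add pderiv_diff pderiv_mult d2 fl by algebra
  have "2 * (a * b) * b1 - b * (a * b1 + b * a1) - b * (a * b1 - a1 * b) = 0"
    by algebra
  then have "2 * k * b1 - b * k1 - b * (M * f ^ 2) = 0"
    unfolding k k1 W' .
  then have E: "2 * k * b1 - b * k1 - M * b * f ^ 2 = 0"
    by (simp only: ac_simps)
  have "f * (f * h1 - 2 * f1 * h - (M + 2) * f * b ^ 2) =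
      b * (2 * k * b1 - b * k1 - M * b * f ^ 2)
      + (4 * f * b1 + 4 * f1 * b) * (f2 * b - 2 * f1 * b1 + f * b2)
      - 4 * f * b * (f3 * b - f2 * b1 - f1 * b2 + f * b3)"
    unfolding k_def k1_def h_def h1_def by algebra
  then have "f * (f * h1 - 2 * f1 * h - (M + 2) * f * b ^ 2) = 0"
    unfolding E D0' D1 by simp
  then have G: "f * h1 - 2 * f1 * h - (M + 2) * f * b ^ 2 = 0"
    using f0 by simp
  have "f * (f * c1 - f1 * c - (M + 2) * b ^ 2) =
      f * (f * c1 + c * f1) - 2 * f1 * (f * c) - (M + 2) * f * b ^ 2"
    by algebra
  then have "f * (f * c1 - f1 * c - (M + 2) * b ^ 2) = 0"
    unfolding h h1 G .
  then have W1: "f * c1 - f1 * c = (M + 2) * b ^ 2"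
    using f0 by simp
  have "pderiv (f * c1 - f1 * c) = pderiv ((M + 2) * b ^ 2)" unfolding W1 ..
  then have W2: "f * c2 - f2 * c = 2 * (M + 2) * b * b1"
    unfolding pderiv_diff pderiv_mult dM power2_eq_square fl by algebra
  have "f * (b2 * c - 2 * b1 * c1 + b * c2) = c * (f2 * b - 2 * f1 * b1 + f * b2)
      - 2 * b1 * ((f * c1 - f1 * c) - (M + 2) * b ^ 2)
      + b * ((f * c2 - f2 * c) - 2 * (M + 2) * b * b1)"
    by algebra
  then have D: "b2 * c - 2 * b1 * c1 + b * c2 = 0"
    unfolding D0' W1 W2 using f0 by simp
  have "M + 2 \<noteq> 0" unfolding M2 of_nat_eq_0_iff by simp
  then have c0: "c \<noteq> 0" using W1 b0 by (auto simp: c1_def)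
  have bf: "b dvd yv_rhs f" unfolding ab[symmetric] by simp
  show "yv_inv (Suc n) f b (yv_rhs b div f)"
    unfolding yv_inv_def c_def[symmetric] fl
  proof (intro conjI allI impI)
    show "poly b1 x \<noteq> 0" if "poly b x = 0" for x
      using sb[OF that] unfolding b1_def .
    show "f * c1 - f1 * c = of_nat (2 * Suc n + 3) * b ^ 2"
      using W1 unfolding M2 .
  qed (use fc bf D b0 c0 in simp_all)
qed

lemma yv_inv: "yv_inv n (yv n) (yv (Suc n)) (yv (Suc (Suc n)))"
proof (induction n)
  case 0
  have "yv (Suc (Suc 0)) = [:4, 0, 0, 1:]"
    by (simp add: yv_rhs_def pderiv_pCons power2_eq_square numeral_poly)
  then show ?case
    by (simp add: yv_inv_def yv_rhs_def pderiv_pCons power2_eq_square numeral_poly)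
next
  case (Suc n)
  then show ?case using yv_inv_step(2) by fastforce
qed

lemma yv_nonzero: "yv n \<noteq> 0"
proof (cases n)
  case (Suc m)
  then show ?thesis using yv_inv[of m] by (simp add: yv_inv_def)
qed simp

theorem yv_recurrence:
  assumes "n \<ge> 1"
  shows "yv (n + 1) * yv (n - 1) =
    [:0, 1:] * yv n ^ 2 - 4 * (yv n * pderiv (pderiv (yv n)) - (pderiv (yv n)) ^ 2)"
proof -
  obtain m where "n = Suc m" using assms by (cases n) auto
  then show ?thesis
    using yv_inv[of m] unfolding yv_inv_def yv_rhs_def[symmetric]
    by (simp add: mult.commute del: yv.simps(3))
qed

theorem yv_unique:
  fixes Q :: "nat \<Rightarrow> complex poly"
  assumes "Q 0 = 1" and "Q 1 = [:0, 1:]"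
    and rec: "\<And>n. n \<ge> 1 \<Longrightarrow> Q (n + 1) * Q (n - 1) =
      [:0, 1:] * Q n ^ 2 - 4 * (Q n * pderiv (pderiv (Q n)) - (pderiv (Q n)) ^ 2)"
  shows "Q n = yv n"
proof (induction n rule: yv.induct)
  case (3 n)
  have "Q (Suc (Suc n)) * yv n = yv (Suc (Suc n)) * yv n"
    using rec[of "Suc n"] yv_recurrence[of "Suc n"] 3 by (simp del: yv.simps(3))
  then show ?case using yv_nonzero[of n] by simp
qed (use assms in auto)

end

(* Reversing the coefficients of Q_n turns the recurrence into one for power series R_n in
   t = 1/z with constant term 1, namely R_{n+1} R_{n-1} = R_n^2 - 4 t^3 (...), where the bracket is
   bilinear in R_n with weights that are polynomial in n. This recurrence preserves series in t^3
   and determines the coefficients of R_{n+1} one after another. Therefore explicit polynomials in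
   n are the coefficients once they satisfy the same convolution identities, and after scaling
   the k-th one by 6^k k! these are identities between univariate integer polynomials, of degree
   at most 36 and invariant under n -> -1 - n, so that 0 <= n <= 18 are enough points to check. *)

theory Submission
  imports Defs
begin

section \<open>Reversed polynomials\<close>

text \<open>For \<open>degree p \<le> m\<close> this is \<open>t^m * p(1/t)\<close>. Reversal at the
  actual degree, as in \<open>reflect_poly\<close>, is multiplicative but not additive; a prescribed
  degree \<open>m\<close> allows differences of polynomials of unequal degrees.\<close>

definition rev_to :: "nat \<Rightarrow> 'a::comm_semiring_1 poly \<Rightarrow> 'a poly" where
  "rev_to m p = monom 1 (m - degree p) * reflect_poly p"

lemma coeff_rev_to:
  assumes "degree p \<le> m"
  shows "coeff (rev_to m p) k = (if k \<le> m then coeff p (m - k) else 0)"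
  using assms by (auto simp: rev_to_def coeff_monom_mult coeff_reflect_poly coeff_eq_0)

text \<open>In an integral domain the degrees of nonzero factors add, hence so do the padding
  exponents \<open>m - degree p\<close> and \<open>l - degree q\<close>.\<close>

lemma rev_to_mult:
  fixes p q :: "'a::idom poly"
  assumes "degree p \<le> m" "degree q \<le> l"
  shows "rev_to (m + l) (p * q) = rev_to m p * rev_to l q"
proof (cases "p = 0 \<or> q = 0")
  case False
  then have "m + l - degree (p * q) = (m - degree p) + (l - degree q)"
    using assms by (simp add: degree_mult_eq)
  moreover have "monom (1::'a) (i + j) = monom 1 i * monom 1 j" for i j
    by (simp add: mult_monom)
  ultimately show ?thesis
    by (simp add: rev_to_def reflect_poly_mult ac_simps)
qed (auto simp: rev_to_def)

lemma rev_to_diff: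
  fixes p q :: "'a::comm_ring_1 poly"
  assumes "degree p \<le> m" "degree q \<le> m"
  shows "rev_to m (p - q) = rev_to m p - rev_to m q"
  by (rule poly_eqI) (simp add: coeff_rev_to assms degree_diff_le)

text \<open>Raising the reversal degree only pads with a power of \<open>t\<close>; this produces
  the factor \<open>t^3\<close> in \<open>yv_rev_mult\<close>.\<close>

lemma rev_to_add_degree:
  assumes "degree p \<le> m"
  shows "rev_to (m + l) p = monom 1 l * rev_to m p"
proof -
  have "m + l - degree p = l + (m - degree p)"
    using assms by simp
  then have "monom (1::'a) (m + l - degree p) = monom 1 l * monom 1 (m - degree p)"
    by (simp add: mult_monom)
  then show ?thesis by (simp add: rev_to_def mult.assoc)
qed

lemma rev_to_monom: "rev_to m (monom 1 m) = (1 :: 'a::comm_ring_1 poly)"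
proof (rule poly_eqI)
  fix k
  show "coeff (rev_to m (monom 1 m)) k = coeff (1 :: 'a poly) k"
    by (cases k) (auto simp: coeff_rev_to degree_monom_le)
qed

section \<open>The Euler operator under reversal\<close>

definition euler_deriv :: "'a::idom poly \<Rightarrow> 'a poly" where
  "euler_deriv p = pCons 0 (pderiv p)"

lemma coeff_euler_deriv: "coeff (euler_deriv p) n = of_nat n * coeff p n"
  by (cases n) (auto simp: euler_deriv_def coeff_pderiv)

lemma degree_euler_deriv_le: "degree (euler_deriv p) \<le> degree p"
  by (rule degree_le) (simp add: coeff_euler_deriv coeff_eq_0)

text \<open>The Euler operator is diagonal on monomials and reversal swaps the indices
  \<open>k\<close> and \<open>m - k\<close>, so it stays diagonal. For \<open>k > m\<close> both
  sides are 0.\<close>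

lemma coeff_rev_to_euler_deriv:
  assumes "degree p \<le> m"
  shows "coeff (rev_to m (euler_deriv p)) k = (of_nat m - of_nat k) * coeff (rev_to m p) k"
  using assms degree_euler_deriv_le[of p]
  by (simp add: coeff_rev_to coeff_euler_deriv of_nat_diff)

text \<open>With \<theta> = z d/dz one has z f' = \<theta> f and z^2 f'' = \<theta>^2 f - \<theta>
  f; the factor z^2 is what converts both derivative terms.\<close>

lemma yv_rhs_euler_deriv:
  "monom 1 2 * yv_rhs f = monom 1 3 * f ^ 2
     - 4 * (f * (euler_deriv (euler_deriv f) - euler_deriv f) - euler_deriv f ^ 2)"
proof -
  define X :: "complex poly" where "X = [:0, 1:]"
  have e: "euler_deriv p = X * pderiv p" for p
    by (simp add: euler_deriv_def X_def)
  have X: "monom 1 k = X ^ k" for k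
    by (simp add: X_def monom_altdef)
  have dX: "pderiv X = 1" by (simp add: X_def pderiv_pCons)
  show ?thesis
    unfolding yv_rhs_def X e X_def[symmetric] pderiv_mult dX
    by (simp add: algebra_simps power2_eq_square power3_eq_cube)
qed

section \<open>The reversed Yablonskii--Vorob'ev polynomials\<close>

definition yv_deg :: "nat \<Rightarrow> nat" where
  "yv_deg n = n * (n + 1) div 2"

lemma two_yv_deg: "2 * yv_deg n = n * (n + 1)"
  by (simp add: yv_deg_def)

lemma yv_deg_Suc_Suc: "yv_deg (Suc (Suc n)) + yv_deg n = 2 * yv_deg (Suc n) + 1"
  using two_yv_deg[of n] two_yv_deg[of "Suc n"] two_yv_deg[of "Suc (Suc n)"]
  by (simp add: algebra_simps)

lemma yv_mult_Suc_Suc: "yv (Suc (Suc n)) * yv n = yv_rhs (yv (Suc n))"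
  using yv_recurrence[of "Suc n"] by (simp add: yv_rhs_def del: yv.simps(3))

text \<open>The term \<open>z * f^2\<close> of degree \<open>2 * degree f + 1\<close> dominates,
  since the derivative terms have degree at most \<open>2 * degree f\<close>.\<close>

lemma degree_lead_coeff_yv_rhs:
  assumes "f \<noteq> 0"
  shows "degree (yv_rhs f) = 2 * degree f + 1" "lead_coeff (yv_rhs f) = lead_coeff f ^ 2"
proof -
  define p where "p = pCons 0 (f ^ 2)"
  define q where "q = - (4 * (f * pderiv (pderiv f) - pderiv f ^ 2))"
  have f: "yv_rhs f = p + q" by (simp add: yv_rhs_def p_def q_def)
  have p: "degree p = 2 * degree f + 1" "lead_coeff p = lead_coeff f ^ 2"
    using assms lead_coeff_power[of f 2] by (simp_all add: p_def degree_power_eq)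
  have "degree (f * pderiv (pderiv f)) \<le> 2 * degree f"
    by (rule order.trans[OF degree_mult_le]) (simp add: degree_pderiv)
  moreover have "degree (pderiv f ^ 2) \<le> 2 * degree f"
    by (rule order.trans[OF degree_power_le]) (simp add: degree_pderiv)
  ultimately have "degree (f * pderiv (pderiv f) - pderiv f ^ 2) \<le> 2 * degree f"
    by (rule degree_diff_le)
  then have "degree q \<le> 2 * degree f"
    unfolding q_def degree_minus
    by (intro order.trans[OF degree_mult_le]) simp
  then have "degree q < degree p" using p by simp
  then show "degree (yv_rhs f) = 2 * degree f + 1" "lead_coeff (yv_rhs f) = lead_coeff f ^ 2"
    using p unfolding f by (simp_all add: degree_add_eq_left coeff_eq_0)
qed

text \<open>Comparing degrees and leading coefficients in the product form
  \<open>yv_mult_Suc_Suc\<close> bypasses the division that defines \<open>yv\<close>.\<close>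

lemma degree_coeff_yv: "degree (yv n) = yv_deg n \<and> coeff (yv n) (yv_deg n) = 1"
proof (induction n rule: yv.induct)
  case (3 n)
  have nz: "yv (Suc (Suc n)) \<noteq> 0" "yv (Suc n) \<noteq> 0" "yv n \<noteq> 0"
    by (rule yv_nonzero)+
  have "degree (yv (Suc (Suc n))) + yv_deg n = 2 * yv_deg (Suc n) + 1"
    using degree_lead_coeff_yv_rhs(1)[OF nz(2)] degree_mult_eq[OF nz(1,3)] 3
    by (simp add: yv_mult_Suc_Suc del: yv.simps(3))
  moreover have "lead_coeff (yv (Suc (Suc n))) = 1"
    using degree_lead_coeff_yv_rhs(2)[OF nz(2)] 3
    unfolding yv_mult_Suc_Suc[symmetric] lead_coeff_mult by (simp del: yv.simps(3))
  moreover have "degree (yv (Suc (Suc n))) = yv_deg (Suc (Suc n))"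
    using calculation(1) yv_deg_Suc_Suc[of n] by linarith
  ultimately show ?case by (simp del: yv.simps(3))
qed (auto simp: yv_deg_def)

lemmas degree_yv = degree_coeff_yv[THEN conjunct1]

section \<open>Recurrence for the reversed polynomials\<close>

definition yv_rev :: "nat \<Rightarrow> complex poly" where
  "yv_rev n = rev_to (yv_deg n) (yv n)"

text \<open>Beyond the degree, truncated subtraction makes \<open>yv_coeff n k\<close> the constant
  coefficient of \<open>yv n\<close>, whereas the reversed polynomial has coefficient 0; hence the
  case distinction.\<close>

lemma coeff_yv_rev: "coeff (yv_rev n) k = (if k \<le> yv_deg n then yv_coeff n k else 0)"
  by (simp add: yv_rev_def coeff_rev_to degree_yv yv_coeff_def yv_deg_def)

lemma coeff_yv_rev_0: "coeff (yv_rev n) 0 = 1"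
  using degree_coeff_yv[of n] by (simp add: yv_rev_def coeff_rev_to)

text \<open>The recurrence times z^2 is reversed at degree \<open>2 * d + 3\<close>. The factors z^2
  and z^3 reverse to 1, while the Euler terms have degree at most \<open>2 * d\<close> and so
  acquire \<open>t^3\<close>.\<close>

lemma yv_rev_mult:
  fixes n
  defines "d \<equiv> yv_deg (Suc n)" and "f \<equiv> yv (Suc n)"
  shows "yv_rev (Suc (Suc n)) * yv_rev n = yv_rev (Suc n) ^ 2
     - monom 1 3 * (4 * (yv_rev (Suc n) *
          (rev_to d (euler_deriv (euler_deriv f)) - rev_to d (euler_deriv f))
        - rev_to d (euler_deriv f) ^ 2))"
proof -
  define e1 where "e1 = euler_deriv f"
  define e2 where "e2 = euler_deriv e1"
  have f: "degree f \<le> d" by (simp add: f_def d_def degree_yv)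
  then have e1: "degree e1 \<le> d"
    unfolding e1_def using degree_euler_deriv_le le_trans by blast
  then have e2: "degree e2 \<le> d"
    unfolding e2_def using degree_euler_deriv_le le_trans by blast
  define B where "B = 4 * (f * (e2 - e1) - e1 ^ 2)"
  have four: "degree (4 :: complex poly) \<le> 0" "rev_to 0 (4 :: complex poly) = 4"
    by (simp_all add: rev_to_def numeral_poly)
  have B': "degree (f * (e2 - e1) - e1 ^ 2) \<le> d + d"
    unfolding power2_eq_square
    by (intro degree_diff_le order.trans[OF degree_mult_le] add_mono f e1 e2)
  then have B: "degree B \<le> d + d"
    unfolding B_def using degree_mult_le[of 4 "f * (e2 - e1) - e1 ^ 2"] four(1) by linarith
  have "rev_to (0 + (d + d)) B = 4 * rev_to (d + d) (f * (e2 - e1) - e1 * e1)"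
    unfolding B_def power2_eq_square
    by (subst rev_to_mult) (use four B' in \<open>simp_all add: power2_eq_square\<close>)
  also have "rev_to (d + d) (f * (e2 - e1) - e1 * e1)
      = rev_to d f * (rev_to d e2 - rev_to d e1) - rev_to d e1 * rev_to d e1"
    by (subst rev_to_diff)
       (auto simp: rev_to_mult rev_to_diff f e1 e2 degree_diff_le
          intro!: order.trans[OF degree_mult_le] add_mono)
  finally have rB: "rev_to (d + d) B =
      4 * (rev_to d f * (rev_to d e2 - rev_to d e1) - rev_to d e1 * rev_to d e1)"
    by simp
  have m: "degree (monom (1::complex) k) \<le> k" for k by (rule degree_monom_le)
  have deg: "2 + (yv_deg (Suc (Suc n)) + yv_deg n) = 3 + (d + d)"
    using yv_deg_Suc_Suc[of n] by (simp add: d_def)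
  have "monom 1 2 * (yv (Suc (Suc n)) * yv n) = monom 1 3 * (f * f) - B"
    unfolding yv_mult_Suc_Suc yv_rhs_euler_deriv f_def[symmetric] e1_def[symmetric]
      e2_def[symmetric] B_def
    by (simp add: power2_eq_square)
  then have "rev_to (2 + (yv_deg (Suc (Suc n)) + yv_deg n))
        (monom 1 2 * (yv (Suc (Suc n)) * yv n))
      = rev_to (3 + (d + d)) (monom 1 3 * (f * f) - B)"
    unfolding deg by (rule arg_cong)
  moreover have "rev_to (2 + (yv_deg (Suc (Suc n)) + yv_deg n))
        (monom 1 2 * (yv (Suc (Suc n)) * yv n)) = yv_rev (Suc (Suc n)) * yv_rev n"
  proof -
    have deg': "degree (yv (Suc (Suc n)) * yv n) \<le> yv_deg (Suc (Suc n)) + yv_deg n"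
      using degree_mult_le[of "yv (Suc (Suc n))" "yv n"]
      by (simp add: degree_yv del: yv.simps)
    show ?thesis
      unfolding rev_to_mult[OF m deg']
      by (simp add: rev_to_mult rev_to_monom degree_yv yv_rev_def del: yv.simps)
  qed
  moreover have "rev_to (3 + (d + d)) (monom 1 3 * (f * f) - B)
      = rev_to d f * rev_to d f - monom 1 3 * rev_to (d + d) B"
  proof -
    have ff: "degree (f * f) \<le> d + d"
      by (intro order.trans[OF degree_mult_le] add_mono f)
    have mff: "degree (monom 1 3 * (f * f)) \<le> 3 + (d + d)"
      by (intro order.trans[OF degree_mult_le] add_mono m ff)
    have "rev_to (3 + (d + d)) B = monom 1 3 * rev_to (d + d) B"
      using rev_to_add_degree[OF B, of 3] by (simp add: add.commute)
    then show ?thesis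
      unfolding rev_to_diff[OF mff trans_le_add2[OF B]] rev_to_mult[OF m ff] rev_to_mult[OF f f]
      by (simp add: rev_to_monom)
  qed
  ultimately show ?thesis
    unfolding rB by (simp add: yv_rev_def f_def d_def e1_def e2_def power2_eq_square)
qed

text \<open>
  The weight is four times the coefficient of \<open>z^a z^b\<close> in \<open>z^2 (f f'' - f'^2)\<close>, that is
  \<open>4 (b (b - 1) - a b)\<close>, where \<open>a\<close> and \<open>b\<close> are \<^term>\<open>yv_deg (Suc n)\<close> minus the indices
  \<open>i\<close> and \<open>j = k - i\<close>.
\<close>

lemma coeff_yv_rev_mult:
  fixes n
  defines "c \<equiv> coeff (yv_rev (Suc n))"
  defines "w \<equiv> \<lambda>i j. (of_nat (Suc n * Suc (Suc n)) - 2 * of_nat j) * (2 * (of_nat i - of_nat j) - 2)"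
  shows "(\<Sum>i\<le>k. coeff (yv_rev (Suc (Suc n))) i * coeff (yv_rev n) (k - i)) =
     (\<Sum>i\<le>k. c i * c (k - i)) -
     (if k < 3 then 0 else \<Sum>i\<le>k - 3. w i (k - 3 - i) * (c i * c (k - 3 - i)))"
proof -
  define d where "d = yv_deg (Suc n)"
  define R where "R = yv_rev (Suc n)"
  define T where "T = rev_to d (euler_deriv (yv (Suc n)))"
  define S where "S = rev_to d (euler_deriv (euler_deriv (yv (Suc n))))"
  \<comment> \<open>Doubling \<open>d\<close> removes the \<open>div\<close> of
    \<open>yv_deg\<close>, so that the weight is a polynomial in \<open>n\<close>.\<close>
  have y: "of_nat (Suc n * Suc (Suc n)) = 2 * (of_nat d :: complex)"
    using two_yv_deg[of "Suc n"] unfolding d_def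
    by (metis Suc_eq_plus1 of_nat_mult of_nat_numeral)
  have w: "w i j = (2 * of_nat d - 2 * of_nat j) * (2 * (of_nat i - of_nat j) - 2)" for i j
    unfolding w_def y ..
  have f: "degree (yv (Suc n)) \<le> d" by (simp add: d_def degree_yv)
  have T: "coeff T j = (of_nat d - of_nat j) * c j" for j
    unfolding T_def c_def yv_rev_def d_def[symmetric] by (rule coeff_rev_to_euler_deriv[OF f])
  have "degree (euler_deriv (yv (Suc n))) \<le> d"
    using f degree_euler_deriv_le le_trans by blast
  then have S: "coeff S j = (of_nat d - of_nat j) ^ 2 * c j" for j
    unfolding S_def using T[of j]
    by (simp add: coeff_rev_to_euler_deriv T_def power2_eq_square)
  define B where "B = 4 * (R * (S - T) - T ^ 2)"
  have B: "coeff B K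
      = (\<Sum>i\<le>K. w i (K - i) * (c i * c (K - i)))" for K
  proof -
    have "B = smult 4 (R * (S - T) - T * T)"
      by (simp add: B_def numeral_poly power2_eq_square)
    then have "coeff B K
        = (\<Sum>i\<le>K. 4 * (c i * (coeff S (K - i) - coeff T (K - i)) - coeff T i * coeff T (K - i)))"
      by (simp add: coeff_mult c_def R_def sum_subtractf sum_distrib_left right_diff_distrib)
    also have "\<dots> = (\<Sum>i\<le>K. w i (K - i) * (c i * c (K - i)))"
      by (rule sum.cong) (simp_all add: S T w algebra_simps power2_eq_square)
    finally show ?thesis .
  qed
  have "coeff (R * R) k = (\<Sum>i\<le>k. c i * c (k - i))"
    by (simp add: coeff_mult c_def R_def)
  moreover have "coeff (monom 1 3 * B) k =
     (if k < 3 then 0 else \<Sum>i\<le>k - 3. w i (k - 3 - i) * (c i * c (k - 3 - i)))"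
    by (simp add: coeff_monom_mult B del: of_nat_mult)
  ultimately have "coeff (R * R - monom 1 3 * B) k =
     (\<Sum>i\<le>k. c i * c (k - i)) -
     (if k < 3 then 0 else \<Sum>i\<le>k - 3. w i (k - 3 - i) * (c i * c (k - 3 - i)))"
    by simp
  moreover have "yv_rev (Suc (Suc n)) * yv_rev n = R * R - monom 1 3 * B"
    using yv_rev_mult[of n] by (simp add: B_def R_def S_def T_def d_def power2_eq_square)
  ultimately show ?thesis by (metis coeff_mult)
qed

section \<open>Vanishing outside the multiples of three\<close>

lemma coeff_yv_rev_eq_0: "\<not> 3 dvd k \<Longrightarrow> coeff (yv_rev n) k = 0"
proof (induction n arbitrary: k rule: yv.induct)
  case (3 n)
  note IH = 3(1,2)
  \<comment> \<open>In a convolution of total index \<open>k\<close> not divisible by three, every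
    product has a factor whose index is not divisible by three. Subtracting three from
    \<open>k\<close> preserves this.\<close>
  have ndvd: "\<not> 3 dvd i \<or> \<not> 3 dvd k - i" if "\<not> 3 dvd k" "i \<le> k" for i k :: nat
    using that by (metis dvd_add le_add_diff_inverse)
  show ?case
    using \<open>\<not> 3 dvd k\<close>
  proof (induction k rule: less_induct)
    case (less k)
    have sq: "coeff (yv_rev (Suc n)) i * coeff (yv_rev (Suc n)) (k' - i) = 0"
      if "\<not> 3 dvd k'" "i \<le> k'" for i k'
      using ndvd[OF that] IH by auto
    have A: "(\<Sum>i\<le>k. coeff (yv_rev (Suc n)) i * coeff (yv_rev (Suc n)) (k - i)) = 0"
      using sq less.prems by (intro sum.neutral) simp
    have B: "(\<Sum>i\<le>k - 3. w i *
        (coeff (yv_rev (Suc n)) i * coeff (yv_rev (Suc n)) (k - 3 - i))) = 0"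
      if "\<not> k < 3" for w
    proof -
      have "\<not> 3 dvd k - 3" using less.prems that by (simp add: dvd_minus_self)
      then show ?thesis using sq[of "k - 3"] by (intro sum.neutral) simp
    qed
    have "(\<Sum>i\<le>k. coeff (yv_rev (Suc (Suc n))) i * coeff (yv_rev n) (k - i)) = 0"
      unfolding coeff_yv_rev_mult A
      by (cases "k < 3") (simp_all only: B if_True if_False diff_zero simp_thms)
    \<comment> \<open>On the left only the term \<open>i = k\<close> is left over, and its second
      factor is the constant term 1 of \<open>yv_rev n\<close>.\<close>
    moreover have "coeff (yv_rev (Suc (Suc n))) i * coeff (yv_rev n) (k - i) = 0" if "i < k" for i
      using ndvd[OF less.prems, of i] IH less.IH[of i] that by auto
    ultimately show ?case
      by (simp add: lessThan_Suc_atMost[symmetric] coeff_yv_rev_0)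
  qed
next
  case 1
  then show ?case by (cases k) (simp_all add: coeff_yv_rev yv_deg_def)
next
  case 2
  then show ?case by (cases k) (simp_all add: coeff_yv_rev yv_coeff_def yv_deg_def)
qed

lemma sum_atMost_3_mult:
  fixes f :: "nat \<Rightarrow> 'a::comm_monoid_add"
  assumes "\<And>i. \<not> 3 dvd i \<Longrightarrow> f i = 0"
  shows "(\<Sum>i\<le>3 * k. f i) = (\<Sum>i\<le>k. f (3 * i))"
proof -
  have "(\<Sum>i\<le>k. f (3 * i)) = sum f ((*) 3 ` {..k})"
    by (subst sum.reindex) (auto simp: inj_on_def)
  also have "\<dots> = (\<Sum>i\<le>3 * k. f i)"
    by (rule sum.mono_neutral_left) (auto intro!: assms)
  finally show ?thesis by simp
qed

text \<open>In the variable \<open>s = t^3\<close> the shift by three becomes a shift by one. The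
  sum over \<open>i < k\<close> is empty for \<open>k = 0\<close>, which absorbs the case
  distinction of \<open>coeff_yv_rev_mult\<close>.\<close>

lemma coeff_yv_rev_mult_3:
  fixes n
  defines "c \<equiv> \<lambda>n i. coeff (yv_rev n) (3 * i)"
  shows "(\<Sum>i\<le>k. c (Suc (Suc n)) i * c n (k - i)) =
     (\<Sum>i\<le>k. c (Suc n) i * c (Suc n) (k - i)) -
     (\<Sum>i<k. (of_nat (Suc n * Suc (Suc n)) - 6 * of_nat (k - 1 - i))
         * (6 * (of_nat i - of_nat (k - 1 - i)) - 2)
         * (c (Suc n) i * c (Suc n) (k - 1 - i)))"
proof -
  have conv: "(\<Sum>i\<le>3 * k. coeff (yv_rev a) i * coeff (yv_rev b) (3 * k - i))
      = (\<Sum>i\<le>k. c a i * c b (k - i))" for a b k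
    unfolding c_def
    by (subst sum_atMost_3_mult) (auto simp: coeff_yv_rev_eq_0 diff_mult_distrib2)
  have conv_weighted: "(\<Sum>i\<le>3 * k. v i (3 * k - i) *
        (coeff (yv_rev a) i * coeff (yv_rev b) (3 * k - i)))
      = (\<Sum>i\<le>k. v (3 * i) (3 * (k - i)) * (c a i * c b (k - i)))" for v a b k
    unfolding c_def
    by (subst sum_atMost_3_mult) (auto simp: coeff_yv_rev_eq_0 diff_mult_distrib2)
  define v where
    "v i j = (of_nat (Suc n * Suc (Suc n)) - 2 * of_nat j) * (2 * (of_nat i - of_nat j) - 2 :: complex)"
    for i j :: nat
  note rec = coeff_yv_rev_mult[of n, folded v_def]
  show ?thesis
  proof (cases k)
    case 0
    then show ?thesis using rec[of 0] by (simp add: c_def)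
  next
    case (Suc k')
    have k: "\<not> 3 * k < 3" "3 * k - 3 = 3 * k'" using Suc by simp_all
    have w: "v (3 * i) (3 * j) = (of_nat (Suc n * Suc (Suc n)) - 6 * of_nat j)
        * (6 * (of_nat i - of_nat j) - 2)" for i j
      by (simp add: v_def algebra_simps)
    have "(\<Sum>i\<le>k. c (Suc (Suc n)) i * c n (k - i)) =
       (\<Sum>i\<le>k. c (Suc n) i * c (Suc n) (k - i)) -
       (\<Sum>i\<le>k'. v (3 * i) (3 * (k' - i)) * (c (Suc n) i * c (Suc n) (k' - i)))"
      using rec[of "3 * k"] unfolding conv k(2) conv_weighted by (simp only: k(1) if_False)
    then show ?thesis
      unfolding w by (simp only: Suc lessThan_Suc_atMost diff_Suc_1)
  qed
qed

section \<open>The closed forms\<close>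

text \<open>
  The closed forms are invariant under \<open>n \<mapsto> - 1 - n\<close> and hence polynomials in
  \<open>n * (n + 1)\<close>. This halves their degree and the number of points that are needed below.
\<close>

definition yv_polys :: "int poly list" where "yv_polys = [
   1,
   [:0, 1:] * [:-2, 1:],
   [:0, 1:] * [:-2, 1:] * [:-6, 1:] * [:-20, 1:],
   [:0, 1:] * [:-2, 1:] * [:-6, 1:] * [:-12, 1:] * [:1120, -58, 1:],
   [:0, 1:] * [:-2, 1:] * [:-6, 1:] * [:-12, 1:] * [:-20, 1:] * [:-110880, 5260, -112, 1:],
   [:0, 1:] * [:-2, 1:] * [:-6, 1:] * [:-12, 1:] * [:-20, 1:] * [:-484323840, 36781248,
     -1132856, 20172, -210, 1:],
   [:0, 1:] * [:-2, 1:] * [:-6, 1:] * [:-12, 1:] * [:-20, 1:] * [:-30, 1:] * [:131736084480,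
     -8183083776, 224411680, -3815240, 43092, -302, 1:],
   [:0, 1:] * [:-2, 1:] * [:-6, 1:] * [:-12, 1:] * [:-20, 1:] * [:-30, 1:] *
     [:1802149635686400, -137527838945280, 4581283892736, -92473908416, 1300329200, -13304912,
     96544, -448, 1:],
   [:0, 1:] * [:-2, 1:] * [:-6, 1:] * [:-12, 1:] * [:-20, 1:] * [:-30, 1:] * [:-42, 1:] *
     [:-56, 1:] * [:16283709208166400, -739989727488000, 16478043633408, -243665841536,
     2661787280, -21986816, 132328, -520, 1:],
   [:0, 1:] * [:-2, 1:] * [:-6, 1:] * [:-12, 1:] * [:-20, 1:] * [:-30, 1:] * [:-42, 1:] *
     [:-28450896728508334080000, 2042498326581057945600, -66362268837214126080,
     1335052236565831680, -19138805446333952, 210869053243648, -1851827613216, 13027721744,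
     -71641360, 290280, -770, 1:]]"

text \<open>At \<open>x = n\<close> this is \<open>6^k * k!\<close> times the claimed coefficient of
  index \<open>3 * k\<close>. A factor \<open>y - m * (m + 1)\<close> of \<open>yv_polys\<close>
  becomes \<open>(x - m) * (x + m + 1)\<close>. Integer arguments admit the reflection at
  -1/2.\<close>

definition yv_num :: "nat \<Rightarrow> int \<Rightarrow> int" where
  "yv_num k x = poly (yv_polys ! k) (x * (x + 1))"

text \<open>The factored forms of the theorem hide the symmetry in \<open>x * (x + 1)\<close>;
  expansion shows that they agree. Index 1 appears as its simp normal form
  \<open>Suc 0\<close>.\<close>

lemma yv_num_expanded:
  "yv_num (Suc 0) x =
     x * (x^2 - 1) * (x + 2)"
  "yv_num 2 x =
     x * (x^2 - 1) * (x^2 - 4) * (x - 4) * (x + 5) * (x + 3)"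
  "yv_num 3 x =
     x * (x^2 - 1) * (x^2 - 4) * (x^2 - 9) * (x + 4) * (x^4 + 2 * x^3 - 57 * x^2 - 58 * x +
       1120)"
  "yv_num 4 x =
     x * (x^2 - 1) * (x^2 - 4) * (x^2 - 9) * (x^2 - 16) * (x + 5) * (x^6 + 3 * x^5 - 109 * x^4
       - 223 * x^3 + 5148 * x^2 + 5260 * x - 110880)"
  "yv_num 5 x =
     x * (x^2 - 1) * (x^2 - 4) * (x^2 - 9) * (x^2 - 16) * (x + 5) * (x^10 + 5 * x^9 - 200 * x^8
       - 830 * x^7 + 18917 * x^6 + 59677 * x^5 - 1072550 * x^4 - 2245540 * x^3 + 35648392 * x^2
       + 36781248 * x - 484323840)"
  "yv_num 6 x =
     x * (x^2 - 1) * (x^2 - 4) * (x^2 - 9) * (x^2 - 16) * (x^2 - 25) * (x + 6) * (x^12 + 6 *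
       x^11 - 287 * x^10 - 1490 * x^9 + 40087 * x^8 + 169354 * x^7 - 3558197 * x^6 - 11273654 *
       x^5 + 213009052 * x^4 + 445008120 * x^3 - 7958672096 * x^2 - 8183083776 * x +
       131736084480)"
  "yv_num 7 x =
     x * (x^2 - 1) * (x^2 - 4) * (x^2 - 9) * (x^2 - 16) * (x^2 - 25) * (x + 6) * (x^16 + 8 *
       x^15 - 420 * x^14 - 3080 * x^13 + 87206 * x^12 + 563640 * x^11 - 11872404 * x^10 -
       64603080 * x^9 + 1168725105 * x^8 + 5068846496 * x^7 - 84738361232 * x^6 - 272233713360
       * x^5 + 4305162496688 * x^4 + 9070093877056 * x^3 - 132946555052544 * x^2 -
       137527838945280 * x + 1802149635686400)"
  "yv_num 8 x =
     x * (x^2 - 1) * (x^2 - 4) * (x^2 - 9) * (x^2 - 16) * (x^2 - 25) * (x^2 - 36) * (x^2 - 49)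
       * (x + 8) * (x^16 + 8 * x^15 - 492 * x^14 - 3584 * x^13 + 121478 * x^12 + 775824 * x^11
       - 20020068 * x^10 - 107298432 * x^9 + 2443900401 * x^8 + 10428074408 * x^7 -
       227804919608 * x^6 - 720372362304 * x^5 + 15749707896080 * x^4 + 32712421425280 * x^3 -
       723511683854592 * x^2 - 739989727488000 * x + 16283709208166400)"
  "yv_num 9 x =
     x * (x^2 - 1) * (x^2 - 4) * (x^2 - 9) * (x^2 - 16) * (x^2 - 25) * (x^2 - 36) * (x + 7) *
       (x^22 + 11 * x^21 - 715 * x^20 - 7535 * x^19 + 255960 * x^18 + 2520582 * x^17 - 61352518
       * x^16 - 548941070 * x^15 + 11058177409 * x^14 + 87218618983 * x^13 - 1583236002911 *
       x^12 - 10658996892035 * x^11 + 183545605960118 * x^10 + 1017581723269944 * x^9 -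
       17057801205684864 * x^8 - 74457629190856880 * x^7 + 1221271897326432992 * x^6 +
       3928812356965402880 * x^5 - 62376250932962964992 * x^4 - 131389485437862420480 * x^3 +
       1976136057743843819520 * x^2 + 2042498326581057945600 * x - 28450896728508334080000)"
  by (simp add: yv_num_def yv_polys_def, algebra)+

section \<open>Finite verification of the convolution identities\<close>

lemma degree_yv_polys:
  assumes "k \<le> 9"
  shows "degree (yv_polys ! k) \<le> 2 * k"
proof -
  from assms have "k = 0 \<or> k = 1 \<or> k = 2 \<or> k = 3 \<or> k = 4 \<or> k = 5 \<or> k = 6 \<or> k = 7
    \<or> k = 8 \<or> k = 9"
    by arith
  then show ?thesis
    by (elim disjE) (simp_all add: yv_polys_def degree_mult_eq)
qed

definition yv_vals :: "int \<Rightarrow> int list" where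
  "yv_vals y = map (\<lambda>p. poly p y) yv_polys"

text \<open>The coefficient recurrence multiplied by \<open>6^k * k!\<close>: denominators turn into
  binomial coefficients, and the weighted sum, of total index \<open>k - 1\<close>, acquires the
  factor \<open>6 * k\<close>. The lists \<open>u\<close>, \<open>v\<close>, \<open>w\<close> stand
  for the numerators at \<open>x - 1\<close>, \<open>x\<close>, \<open>x + 1\<close>; as parameters
  they can be evaluated before substitution.\<close>

definition yv_check :: "nat \<Rightarrow> int \<Rightarrow> int list \<Rightarrow> int list \<Rightarrow> int list \<Rightarrow> bool" where
  "yv_check k x u v w \<longleftrightarrow>
     (\<Sum>i\<le>k. int (k choose i) * (w ! i * u ! (k - i))) =
     (\<Sum>i\<le>k. int (k choose i) * (v ! i * v ! (k - i))) -
     6 * int k * (\<Sum>i<k. int ((k - 1) choose i) * ((x * (x + 1) - 6 * int (k - 1 - i))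
         * (6 * (int i - int (k - 1 - i)) - 2) * (v ! i * v ! (k - 1 - i))))"

definition yv_checks :: "int \<Rightarrow> int list \<Rightarrow> int list \<Rightarrow> int list \<Rightarrow> bool" where
  "yv_checks x u v w \<longleftrightarrow> (\<forall>k\<in>{..9}. yv_check k x u v w)"

text \<open>The three list arguments are the values of \<open>y * (y + 1)\<close> at
  \<open>y = x - 1\<close>, \<open>x\<close> and \<open>x + 1\<close>.\<close>

lemma yv_check_vals:
  assumes "k \<le> 9" and check: "yv_checks x (yv_vals ((x - 1) * x)) (yv_vals (x * (x + 1)))
    (yv_vals ((x + 1) * (x + 2)))"
  shows "(\<Sum>i\<le>k. int (k choose i) * (yv_num i (x + 1) * yv_num (k - i) (x - 1))) =
     (\<Sum>i\<le>k. int (k choose i) * (yv_num i x * yv_num (k - i) x)) -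
     6 * int k * (\<Sum>i<k. int ((k - 1) choose i) * ((x * (x + 1) - 6 * int (k - 1 - i))
         * (6 * (int i - int (k - 1 - i)) - 2) * (yv_num i x * yv_num (k - 1 - i) x)))"
proof -
  have "length yv_polys = 10" by (simp add: yv_polys_def)
  then have nth: "yv_vals ((x - 1) * x) ! i = yv_num i (x - 1)"
    "yv_vals (x * (x + 1)) ! i = yv_num i x" "yv_vals ((x + 1) * (x + 2)) ! i = yv_num i (x + 1)"
    if "i \<le> k" for i
    using that \<open>k \<le> 9\<close> by (simp_all add: yv_vals_def yv_num_def algebra_simps)
  have "yv_check k x (yv_vals ((x - 1) * x)) (yv_vals (x * (x + 1)))
      (yv_vals ((x + 1) * (x + 2)))"
    using check \<open>k \<le> 9\<close> by (simp add: yv_checks_def)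
  moreover have "(\<Sum>i\<le>k. a i * (yv_vals ((x + 1) * (x + 2)) ! i * yv_vals ((x - 1) * x) ! (k - i)))
      = (\<Sum>i\<le>k. a i * (yv_num i (x + 1) * yv_num (k - i) (x - 1)))"
    "(\<Sum>i\<le>k. a i * (yv_vals (x * (x + 1)) ! i * yv_vals (x * (x + 1)) ! (k - i)))
      = (\<Sum>i\<le>k. a i * (yv_num i x * yv_num (k - i) x))"
    "(\<Sum>i<k. a i * (b i * (yv_vals (x * (x + 1)) ! i * yv_vals (x * (x + 1)) ! (k - 1 - i))))
      = (\<Sum>i<k. a i * (b i * (yv_num i x * yv_num (k - 1 - i) x)))" for a b
    by (rule sum.cong; simp add: nth)+
  ultimately show ?thesis
    unfolding yv_check_def by (simp only:)
qed

context
  notes numeral_eq_Suc [simp] lessThan_Suc [simp] atMost_Suc [simp] power_Suc [simp del]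
begin

text \<open>The sums are unfolded once for all sample points, which then only require substitution
  of \<open>x\<close> and the list entries.\<close>

lemmas yv_checks_unfold = yv_checks_def[simplified]
  yv_check_def[of 0, simplified] yv_check_def[of "Suc 0", simplified]
  yv_check_def[of 2, simplified] yv_check_def[of 3, simplified] yv_check_def[of 4, simplified]
  yv_check_def[of 5, simplified] yv_check_def[of 6, simplified] yv_check_def[of 7, simplified]
  yv_check_def[of 8, simplified] yv_check_def[of 9, simplified]

end

lemma yv_checks_le_18:
  assumes "m \<le> 18"
  shows "yv_checks (int m) (yv_vals ((int m - 1) * int m)) (yv_vals (int m * (int m + 1)))
    (yv_vals ((int m + 1) * (int m + 2)))"
proof -
  have "m = 0 \<or> m = 1 \<or> m = 2 \<or> m = 3 \<or> m = 4 \<or> m = 5 \<or> m = 6 \<or> m = 7 \<or> m = 8 \<or> m = 9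
    \<or> m = 10 \<or> m = 11 \<or> m = 12 \<or> m = 13 \<or> m = 14 \<or> m = 15 \<or> m = 16 \<or> m = 17 \<or> m = 18"
    using assms by arith
  then show ?thesis
    (* The stages force the lists of values to become literals before they are substituted into the
       convolutions, where each of them occurs many times. *)
    by (elim disjE; (hypsubst, simp,
          simp only: yv_vals_def yv_polys_def list.map poly_mult poly_pCons poly_0 poly_1,
          simp, simp only: yv_checks_unfold, simp))
qed

text \<open>
  The difference of both sides is a polynomial of degree at most \<open>4 * k \<le> 36\<close> in \<open>x\<close>, and it
  vanishes at the 38 points \<open>-19, \<dots>, 18\<close>.
\<close>

lemma yv_num_identity:
  assumes "k \<le> 9"
  shows "(\<Sum>i\<le>k. int (k choose i) * (yv_num i (x + 1) * yv_num (k - i) (x - 1))) =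
     (\<Sum>i\<le>k. int (k choose i) * (yv_num i x * yv_num (k - i) x)) -
     6 * int k * (\<Sum>i<k. int ((k - 1) choose i) * ((x * (x + 1) - 6 * int (k - 1 - i))
         * (6 * (int i - int (k - 1 - i)) - 2) * (yv_num i x * yv_num (k - 1 - i) x)))"
proof -
  \<comment> \<open>The inner polynomials are \<open>(x + 1) * (x + 2)\<close>,
    \<open>(x - 1) * x\<close> and \<open>x * (x + 1)\<close>; \<open>D\<close> is the difference of
    the two sides.\<close>
  define A where "A i = pcompose (yv_polys ! i) [:2, 3, 1:]" for i
  define B where "B i = pcompose (yv_polys ! i) [:0, -1, 1:]" for i
  define C where "C i = pcompose (yv_polys ! i) [:0, 1, 1:]" for i
  define D where "D =
     (\<Sum>i\<le>k. smult (int (k choose i)) (A i * B (k - i))) -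
     ((\<Sum>i\<le>k. smult (int (k choose i)) (C i * C (k - i))) -
     smult (6 * int k) (\<Sum>i<k. smult (int ((k - 1) choose i)) ([:- (6 * int (k - 1 - i)), 1, 1:]
         * [:6 * (int i - int (k - 1 - i)) - 2:] * (C i * C (k - 1 - i)))))"
  have eval: "poly (A i) y = yv_num i (y + 1)" "poly (B i) y = yv_num i (y - 1)"
    "poly (C i) y = yv_num i y" for i y
    by (simp_all add: A_def B_def C_def yv_num_def poly_pcompose algebra_simps)
  have D: "poly D y =
     (\<Sum>i\<le>k. int (k choose i) * (yv_num i (y + 1) * yv_num (k - i) (y - 1))) -
     ((\<Sum>i\<le>k. int (k choose i) * (yv_num i y * yv_num (k - i) y)) -
     6 * int k * (\<Sum>i<k. int ((k - 1) choose i) * ((y * (y + 1) - 6 * int (k - 1 - i))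
         * (6 * (int i - int (k - 1 - i)) - 2) * (yv_num i y * yv_num (k - 1 - i) y))))" for y
    by (simp add: D_def poly_sum eval algebra_simps)
  have deg: "degree (A i) \<le> 4 * i" "degree (B i) \<le> 4 * i" "degree (C i) \<le> 4 * i"
    if "i \<le> k" for i
    using degree_yv_polys[of i] that assms
    by (simp_all add: A_def B_def C_def degree_pcompose)
  have degM: "degree (p * q) \<le> n" if "degree p + degree q \<le> n" for p q :: "int poly" and n
    using degree_mult_le that le_trans by blast
  have "degree D \<le> 4 * k"
    unfolding D_def
  proof (intro degree_diff_le degree_sum_le order.trans[OF degree_smult_le])
    fix i assume "i \<in> {..k}"
    then have i: "i \<le> k" "k - i \<le> k" "4 * i + 4 * (k - i) \<le> 4 * k" by auto
    show "degree (A i * B (k - i)) \<le> 4 * k"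
      using deg(1)[OF i(1)] deg(2)[OF i(2)] i(3) by (intro degM) linarith
    show "degree (C i * C (k - i)) \<le> 4 * k"
      using deg(3)[OF i(1)] deg(3)[OF i(2)] i(3) by (intro degM) linarith
  next
    \<comment> \<open>The weight has degree two and the total index is \<open>k - 1\<close>, so
      these summands even have degree at most \<open>4 * k - 2\<close>.\<close>
    fix i assume "i \<in> {..<k}"
    then have i: "i \<le> k" "k - 1 - i \<le> k" "2 + 0 + (4 * i + 4 * (k - 1 - i)) \<le> 4 * k" by auto
    have "degree (C i * C (k - 1 - i)) \<le> 4 * i + 4 * (k - 1 - i)"
      using deg(3)[OF i(1)] deg(3)[OF i(2)] by (intro degM add_mono)
    moreover have "degree ([:a, 1, 1:] * [:b:]) \<le> 2 + 0" for a b :: int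
      by (intro degM) simp
    ultimately show "degree ([:- (6 * int (k - 1 - i)), 1, 1:] * [:6 * (int i - int (k - 1 - i)) - 2:]
        * (C i * C (k - 1 - i))) \<le> 4 * k"
      using i(3) add_mono le_trans by (intro degM) blast
  qed auto
  have flip: "yv_num i (- 1 - y) = yv_num i y" for i y
    by (simp add: yv_num_def algebra_simps)
  \<comment> \<open>The reflection interchanges the roles of the neighbours \<open>y + 1\<close> and
    \<open>y - 1\<close>.\<close>
  have mult_flip: "yv_num i (- 1 - y + 1) = yv_num i (y - 1)"
    "yv_num i (- 1 - y - 1) = yv_num i (y + 1)" for i y
    using flip[of i "y - 1"] flip[of i "y + 1"] by (simp_all add: algebra_simps)
  have sym: "poly D (- 1 - y) = poly D y" for y
  proof -
    \<comment> \<open>Reversing the order of summation undoes this interchange, because binomial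
      coefficients are symmetric.\<close>
    have "(\<Sum>i\<le>k. int (k choose i) * (yv_num i (y - 1) * yv_num (k - i) (y + 1))) =
        (\<Sum>i\<le>k. int (k choose i) * (yv_num i (y + 1) * yv_num (k - i) (y - 1)))"
      by (rule sum.reindex_bij_witness[of _ "\<lambda>i. k - i" "\<lambda>i. k - i"])
         (auto simp: binomial_symmetric[symmetric])
    moreover have "(- 1 - y) * (- 1 - y + 1) = y * (y + 1)"
      by algebra
    ultimately show ?thesis
      unfolding D mult_flip flip by simp
  qed
  have small: "poly D (int m) = 0" if "m \<le> 18" for m
    using yv_check_vals[OF assms yv_checks_le_18[OF that]] unfolding D by simp
  \<comment> \<open>The reflection maps the points -19 to -1 onto 0 to 18, where the identity has
    been computed.\<close>
  have "poly D y = poly 0 y" if "y \<in> {-19..18}" for y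
  proof (cases "y \<ge> 0")
    case True
    then show ?thesis using small[of "nat y"] that by simp
  next
    case False
    then have "poly D (- 1 - y) = 0" using small[of "nat (- 1 - y)"] that by simp
    then show ?thesis by (simp add: sym)
  qed
  then have "D = 0"
    by (rule poly_eqI_degree[of "{-19..18}"]) (use \<open>degree D \<le> 4 * k\<close> assms in auto)
  then show ?thesis using D[of x] by simp
qed

section \<open>From integer identities to the coefficients\<close>

definition yv_closed :: "nat \<Rightarrow> nat \<Rightarrow> complex" where
  "yv_closed n k = of_int (yv_num k (int n)) / (6 ^ k * fact k)"

text \<open>The powers of 6 multiply to \<open>6^k\<close>, and replacing
  \<open>i! * (k - i)!\<close> by \<open>k!\<close> costs the binomial coefficient.\<close>

lemma yv_closed_mult:
  assumes "i \<le> k"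
  shows "yv_closed n i * yv_closed m (k - i) =
    of_int (int (k choose i) * (yv_num i (int n) * yv_num (k - i) (int m))) / (6 ^ k * fact k)"
proof -
  have "(6::complex) ^ k = 6 ^ i * 6 ^ (k - i)"
    using assms by (simp flip: power_add)
  moreover have "(of_nat (k choose i) :: complex) = fact k / (fact i * fact (k - i))"
    using assms by (rule binomial_fact)
  ultimately show ?thesis
    by (simp add: yv_closed_def)
qed

lemma yv_closed_recurrence:
  assumes "k \<le> 9"
  shows "(\<Sum>i\<le>k. yv_closed (Suc (Suc n)) i * yv_closed n (k - i)) =
     (\<Sum>i\<le>k. yv_closed (Suc n) i * yv_closed (Suc n) (k - i)) -
     (\<Sum>i<k. (of_nat (Suc n * Suc (Suc n)) - 6 * of_nat (k - 1 - i))
         * (6 * (of_nat i - of_nat (k - 1 - i)) - 2)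
         * (yv_closed (Suc n) i * yv_closed (Suc n) (k - 1 - i)))"
proof -
  define N :: complex where "N = 6 ^ k * fact k"
  define x where "x = int (Suc n)"
  have x: "int (Suc (Suc n)) = x + 1" "int n = x - 1" "int (Suc n) = x"
    by (simp_all add: x_def)
  have y: "of_nat (Suc n * Suc (Suc n)) = (of_int (x * (x + 1)) :: complex)"
    by (simp add: x_def algebra_simps)
  have "(\<Sum>i\<le>k. yv_closed a i * yv_closed b (k - i)) =
      of_int (\<Sum>i\<le>k. int (k choose i) * (yv_num i (int a) * yv_num (k - i) (int b))) / N" for a b
    unfolding N_def of_int_sum sum_divide_distrib
    by (rule sum.cong) (simp_all only: yv_closed_mult atMost_iff)
  moreover have "(\<Sum>i<k. (of_nat (Suc n * Suc (Suc n)) - 6 * of_nat (k - 1 - i))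
         * (6 * (of_nat i - of_nat (k - 1 - i)) - 2)
         * (yv_closed (Suc n) i * yv_closed (Suc n) (k - 1 - i))) =
      of_int (6 * int k * (\<Sum>i<k. int ((k - 1) choose i) * ((x * (x + 1) - 6 * int (k - 1 - i))
         * (6 * (int i - int (k - 1 - i)) - 2) * (yv_num i x * yv_num (k - 1 - i) x)))) / N"
  proof (cases k)
    case (Suc k')
    \<comment> \<open>The weighted sum has the natural denominator \<open>6^k' * fact k'\<close>;
      passing to \<open>N\<close> introduces the factor \<open>6 * k\<close>.\<close>
    have N: "N = 6 * of_nat k * (6 ^ k' * fact k')" by (simp add: N_def Suc)
    have "yv_closed (Suc n) i * yv_closed (Suc n) (k' - i) =
        6 * of_nat k * of_int (int (k' choose i) * (yv_num i x * yv_num (k' - i) x)) / N"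
      if "i < k" for i
    proof -
      have "i \<le> k'" "(of_nat k :: complex) \<noteq> 0"
        unfolding of_nat_eq_0_iff using that Suc by simp_all
      then show ?thesis by (simp add: yv_closed_mult N x)
    qed
    then show ?thesis
      unfolding y of_int_mult[of "6 * int k"] of_int_sum sum_distrib_left sum_divide_distrib
      by (intro sum.cong) (simp_all add: Suc)
  qed simp
  ultimately show ?thesis
    unfolding yv_num_identity[OF assms, of x] x
    by (simp only: yv_num_identity[OF assms, of x] of_int_diff diff_divide_distrib x)
qed

lemma yv_num_0: "yv_num 0 x = 1"
  by (simp add: yv_num_def yv_polys_def)

text \<open>Every nonconstant entry of \<open>yv_polys\<close> contains \<open>y * (y - 2)\<close>,
  which vanishes for \<open>y = x * (x + 1)\<close> at 0 and 1. This gives the base cases Q_0 = 1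
  and Q_1 = z.\<close>

lemma yv_num_Suc_eq_0:
  assumes "x = 0 \<or> x = 1" "k < 9"
  shows "yv_num (Suc k) x = 0"
proof -
  from \<open>k < 9\<close> have "k = 0 \<or> k = 1 \<or> k = 2 \<or> k = 3 \<or> k = 4 \<or> k = 5 \<or> k = 6 \<or> k = 7
    \<or> k = 8"
    by arith
  then show ?thesis using assms(1) by (elim disjE) (simp_all add: yv_num_def yv_polys_def)
qed

text \<open>Both families satisfy the same recurrence and have constant term 1. Given the indices
  \<open>n\<close> and \<open>n + 1\<close>, the summand \<open>i = k\<close> determines the k-th
  coefficient at \<open>n + 2\<close> from the lower ones, hence the induction on \<open>k\<close>
  inside that on \<open>n\<close>.\<close>

lemma coeff_yv_rev_closed:
  "k \<le> 9 \<Longrightarrow> coeff (yv_rev n) (3 * k) = yv_closed n k"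
proof (induction n arbitrary: k rule: yv.induct)
  case (3 n)
  let ?c = "\<lambda>n i. coeff (yv_rev n) (3 * i)"
  note IH = 3(1,2)
  show ?case
    using \<open>k \<le> 9\<close>
  proof (induction k rule: less_induct)
    case (less k)
    have "(\<Sum>i\<le>k. ?c (Suc (Suc n)) i * ?c n (k - i)) =
        (\<Sum>i\<le>k. yv_closed (Suc (Suc n)) i * yv_closed n (k - i))"
      unfolding coeff_yv_rev_mult_3 yv_closed_recurrence[OF less.prems]
      using less.prems by (intro arg_cong2[of _ _ _ _ minus] sum.cong) (simp_all add: IH)
    moreover have "(\<Sum>i<k. ?c (Suc (Suc n)) i * ?c n (k - i)) =
        (\<Sum>i<k. yv_closed (Suc (Suc n)) i * yv_closed n (k - i))"
      using less.prems by (intro sum.cong) (simp_all add: IH less.IH)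
    ultimately show ?case
      by (simp add: lessThan_Suc_atMost[symmetric] coeff_yv_rev_0 yv_closed_def yv_num_0)
  qed
next
  case 1
  then show ?case
    by (cases k) (simp_all add: coeff_yv_rev yv_coeff_def yv_deg_def yv_closed_def yv_num_0
        yv_num_Suc_eq_0)
next
  case 2
  then show ?case
    by (cases k) (simp_all add: coeff_yv_rev yv_coeff_def yv_deg_def yv_closed_def yv_num_0
        yv_num_Suc_eq_0)
qed

section \<open>The expansion in powers of z and its first coefficients\<close>

lemma yv_eq_sum_monom:
  "yv n = (\<Sum>k\<le>yv_deg n div 3. monom (yv_coeff n (3 * k)) (yv_deg n - 3 * k))"
proof (rule poly_eqI)
  fix m
  define d where "d = yv_deg n"
  have *: "coeff (\<Sum>k\<le>d div 3. monom (yv_coeff n (3 * k)) (d - 3 * k)) m =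
      (\<Sum>k\<le>d div 3. if d - 3 * k = m then yv_coeff n (3 * k) else 0)"
    by (simp add: coeff_sum)
  show "coeff (yv n) m = coeff (\<Sum>k\<le>yv_deg n div 3.
      monom (yv_coeff n (3 * k)) (yv_deg n - 3 * k)) m"
    unfolding d_def[symmetric] *
  proof (cases "m \<le> d \<and> 3 dvd d - m")
    case True
    then obtain j where j: "d - m = 3 * j" by (elim conjE dvdE)
    \<comment> \<open>The bound \<open>k \<le> d div 3\<close> rules out truncation in
      \<open>d - 3 * k\<close>, so exactly one summand has exponent \<open>m\<close>.\<close>
    then have "d - 3 * k = m \<longleftrightarrow> k = j" if "k \<le> d div 3" for k
      using that True by auto
    then have "(\<Sum>k\<le>d div 3. if d - 3 * k = m then yv_coeff n (3 * k) else 0) =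
        (\<Sum>k\<le>d div 3. if k = j then yv_coeff n (3 * k) else 0)"
      by (intro sum.cong) auto
    also have "\<dots> = yv_coeff n (d - m)" using j by simp
    also have "\<dots> = coeff (yv n) m"
      using True by (simp add: yv_coeff_def d_def yv_deg_def)
    finally show "coeff (yv n) m =
      (\<Sum>k\<le>d div 3. if d - 3 * k = m then yv_coeff n (3 * k) else 0)" by simp
  next
    case False
    \<comment> \<open>Either \<open>m\<close> exceeds the degree, or \<open>d - m\<close> is not a
      multiple of three.\<close>
    have "coeff (yv n) m = 0"
    proof (cases "m \<le> d")
      case True
      then show ?thesis
        using coeff_yv_rev_eq_0[of "d - m" n] False
        by (simp add: coeff_yv_rev d_def yv_coeff_def yv_deg_def)
    qed (simp add: coeff_eq_0 degree_yv d_def)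
    moreover have "d - 3 * k \<noteq> m" if "k \<le> d div 3" for k
      using that False by auto
    ultimately show "coeff (yv n) m =
      (\<Sum>k\<le>d div 3. if d - 3 * k = m then yv_coeff n (3 * k) else 0)" by simp
  qed
qed

theorem mainTheorem6:
  fixes n :: nat
  assumes "n \<ge> 1"
  shows "let d = n * (n + 1) div 2; x = (of_nat n :: complex) in
     yv_coeff n 0 = 1 \<and>
     yv n = (\<Sum>k\<le>d div 3. monom (yv_coeff n (3 * k)) (d - 3 * k)) \<and>
     (3 \<le> d \<longrightarrow> yv_coeff n 3 =
        x / 6 * (x^2 - 1) * (x + 2)) \<and>
     (6 \<le> d \<longrightarrow> yv_coeff n 6 =
        x / 72 * (x^2 - 1) * (x^2 - 4) * (x - 4) * (x + 5) * (x + 3)) \<and>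
     (9 \<le> d \<longrightarrow> yv_coeff n 9 =
        x / 1296 * (x^2 - 1) * (x^2 - 4) * (x^2 - 9) * (x + 4)
          * (x^4 + 2 * x^3 - 57 * x^2 - 58 * x + 1120)) \<and>
     (12 \<le> d \<longrightarrow> yv_coeff n 12 =
        x / 31104 * (x^2 - 1) * (x^2 - 4) * (x^2 - 9) * (x^2 - 16) * (x + 5) * (x^6 + 3 * x^5
          - 109 * x^4 - 223 * x^3 + 5148 * x^2 + 5260 * x - 110880)) \<and>
     (15 \<le> d \<longrightarrow> yv_coeff n 15 =
        x / 933120 * (x^2 - 1) * (x^2 - 4) * (x^2 - 9) * (x^2 - 16) * (x + 5) * (x^10 + 5 * x^9
          - 200 * x^8 - 830 * x^7 + 18917 * x^6 + 59677 * x^5 - 1072550 * x^4 - 2245540 * x^3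
          + 35648392 * x^2 + 36781248 * x - 484323840)) \<and>
     (18 \<le> d \<longrightarrow> yv_coeff n 18 =
        x / 33592320 * (x^2 - 1) * (x^2 - 4) * (x^2 - 9) * (x^2 - 16) * (x^2 - 25) * (x + 6)
          * (x^12 + 6 * x^11 - 287 * x^10 - 1490 * x^9 + 40087 * x^8 + 169354 * x^7 - 3558197 * x^6
          - 11273654 * x^5 + 213009052 * x^4 + 445008120 * x^3 - 7958672096 * x^2 - 8183083776 * x
          + 131736084480)) \<and>
     (21 \<le> d \<longrightarrow> yv_coeff n 21 =
        x / 1410877440 * (x^2 - 1) * (x^2 - 4) * (x^2 - 9) * (x^2 - 16) * (x^2 - 25) * (x + 6)
          * (x^16 + 8 * x^15 - 420 * x^14 - 3080 * x^13 + 87206 * x^12 + 563640 * x^11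
          - 11872404 * x^10 - 64603080 * x^9 + 1168725105 * x^8 + 5068846496 * x^7
          - 84738361232 * x^6 - 272233713360 * x^5 + 4305162496688 * x^4 + 9070093877056 * x^3
          - 132946555052544 * x^2 - 137527838945280 * x + 1802149635686400)) \<and>
     (24 \<le> d \<longrightarrow> yv_coeff n 24 =
        x / 67722117120 * (x^2 - 1) * (x^2 - 4) * (x^2 - 9) * (x^2 - 16) * (x^2 - 25)
          * (x^2 - 36) * (x^2 - 49) * (x + 8) * (x^16 + 8 * x^15 - 492 * x^14 - 3584 * x^13
          + 121478 * x^12 + 775824 * x^11 - 20020068 * x^10 - 107298432 * x^9 + 2443900401 * x^8
          + 10428074408 * x^7 - 227804919608 * x^6 - 720372362304 * x^5 + 15749707896080 * x^4
          + 32712421425280 * x^3 - 723511683854592 * x^2 - 739989727488000 * x + 16283709208166400)) \<and>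
     (27 \<le> d \<longrightarrow> yv_coeff n 27 =
        x / 3656994324480 * (x^2 - 1) * (x^2 - 4) * (x^2 - 9) * (x^2 - 16) * (x^2 - 25)
          * (x^2 - 36) * (x + 7) * (x^22 + 11 * x^21 - 715 * x^20 - 7535 * x^19 + 255960 * x^18
          + 2520582 * x^17 - 61352518 * x^16 - 548941070 * x^15 + 11058177409 * x^14
          + 87218618983 * x^13 - 1583236002911 * x^12 - 10658996892035 * x^11
          + 183545605960118 * x^10 + 1017581723269944 * x^9 - 17057801205684864 * x^8
          - 74457629190856880 * x^7 + 1221271897326432992 * x^6 + 3928812356965402880 * x^5
          - 62376250932962964992 * x^4 - 131389485437862420480 * x^3 + 1976136057743843819520 * x^2
          + 2042498326581057945600 * x - 28450896728508334080000))"
proof -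
  have c0: "yv_coeff n 0 = 1"
    using coeff_yv_rev_0[of n] by (simp add: coeff_yv_rev)
  \<comment> \<open>The bound on \<open>j\<close> selects the branch of \<open>coeff_yv_rev\<close>
    in which the subtraction is not truncated.\<close>
  have c: "yv_coeff n j = yv_closed n k" if "j = 3 * k" "k \<le> 9" "j \<le> n * (n + 1) div 2" for j k
    using coeff_yv_rev_closed[of k n] that by (simp add: coeff_yv_rev yv_deg_def)
  show ?thesis
    unfolding Let_def
    by (intro conjI impI c0 yv_eq_sum_monom[unfolded yv_deg_def]; 
       subst c[of 3 1] c[of 6 2] c[of 9 3] c[of 12 4] c[of 15 5] c[of 18 6] c[of 21 7] c[of 24 8]
         c[of 27 9])
       (simp_all add: yv_closed_def yv_num_expanded fact_numeral)
qed

end
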